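(* Let $G$ be a connected graph with $\gamma_I^p(G)>2$. Then $\gamma_I^p(G)=3$ if and only if the complement $\overline{G}$ has a perfect dominating set of size $3$.
   Context: All graphs are finite, simple and undirected; $\overline{G}$ denotes the complement of $G$. For a graph $G=(V,E)$ and $v\in V$, $N(v)$ denotes the set of neighbours of $v$. A perfect Italian dominating function (PID-function) of $G$ is a function $f:V\to\{0,1,2\}$ such that for every vertex $v$ with $f(v)=0$ one has $\sum_{u\in N(v)} f(u)=2$. The weight of $f$ is $\sum_{v\in V} f(v)$; $\gamma_I^p(G)$ is the minimum weight of a PID-function of $G$. A perfect dominating set of a graph $H$ is a dominating set $D$ of $H$ such that every vertex of $H$ not in $D$ has exactly one neighbour in $D$. *)

theory Defs
  imports "Graph_Theory.Digraph_Component" "HOL-Library.FuncSet"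
begin

text \<open>
  A finite simple undirected graph is a \<^locale>\<open>pair_graph\<close>: an edge \<open>uv\<close> is represented by the
  two arcs \<open>(u, v)\<close> and \<open>(v, u)\<close>.
\<close>

definition neighbours :: "'a pair_pre_digraph \<Rightarrow> 'a \<Rightarrow> 'a set" where
  "neighbours G v = {u \<in> pverts G. (v, u) \<in> parcs G}"

definition complement :: "'a pair_pre_digraph \<Rightarrow> 'a pair_pre_digraph" where
  "complement G =
     \<lparr> pverts = pverts G,
       parcs = {(u, v). u \<in> pverts G \<and> v \<in> pverts G \<and> u \<noteq> v \<and> (u, v) \<notin> parcs G} \<rparr>"

text \<open>Values of \<open>f\<close> outside the vertex set are unconstrained, and irrelevant below.\<close>

definition pid_function :: "'a pair_pre_digraph \<Rightarrow> ('a \<Rightarrow> nat) \<Rightarrow> bool" where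
  "pid_function G f \<longleftrightarrow>
     f \<in> pverts G \<rightarrow> {0, 1, 2} \<and>
     (\<forall>v \<in> pverts G. f v = 0 \<longrightarrow> (\<Sum>u \<in> neighbours G v. f u) = 2)"

definition weight :: "'a pair_pre_digraph \<Rightarrow> ('a \<Rightarrow> nat) \<Rightarrow> nat" where
  "weight G f = (\<Sum>v \<in> pverts G. f v)"

definition perfect_Italian_domination_number :: "'a pair_pre_digraph \<Rightarrow> nat" where
  "perfect_Italian_domination_number G = (LEAST w. \<exists>f. pid_function G f \<and> weight G f = w)"

definition dominating_set :: "'a pair_pre_digraph \<Rightarrow> 'a set \<Rightarrow> bool" where
  "dominating_set G D \<longleftrightarrow>
     D \<subseteq> pverts G \<and> (\<forall>v \<in> pverts G - D. neighbours G v \<inter> D \<noteq> {})"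

definition perfect_dominating_set :: "'a pair_pre_digraph \<Rightarrow> 'a set \<Rightarrow> bool" where
  "perfect_dominating_set G D \<longleftrightarrow>
     dominating_set G D \<and> (\<forall>v \<in> pverts G - D. card (neighbours G v \<inter> D) = 1)"

lemma pair_graph_complement:
  assumes "pair_graph G"
  shows "pair_graph (complement G)"
proof -
  interpret pair_graph G by fact
  have "finite (parcs (complement G))"
    by (rule finite_subset[of _ "pverts G \<times> pverts G"])
      (auto simp: complement_def pair_finite_verts)
  then show ?thesis
    by unfold_locales
      (auto simp: complement_def pair_finite_verts symmetric_def intro!: symI dest: arcs_symmetric)
qed

text \<open>The minimum defining the domination number ranges over a nonempty set.\<close>

lemma pid_function_const_1: "pid_function G (\<lambda>_. 1)"
  by (auto simp: pid_function_def)

end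

theory Submission
  imports Defs "HOL-Library.Indicator_Function"
begin

text \<open>
  An indicator function of a three-element set \<open>D\<close> is a PID-function iff every vertex outside \<open>D\<close>
  has exactly two neighbours in \<open>D\<close>, i.e. exactly one neighbour in \<open>D\<close> in the complement.
  The only other weight-3 functions take the value 2 at one vertex \<open>a\<close> and 1 at one vertex \<open>b\<close>. Then
  all the remaining vertices are adjacent to \<open>a\<close> but not to \<open>b\<close>, so connectedness makes \<open>b\<close>
  adjacent to \<open>a\<close>, and putting 2 on \<open>a\<close> alone gives a PID-function of weight 2.
\<close>

lemma perfect_Italian_domination_number_le:
  assumes "pid_function G f"
  shows "perfect_Italian_domination_number G \<le> weight G f"
  unfolding perfect_Italian_domination_number_def using assms by (auto intro: Least_le)

lemma perfect_Italian_domination_number_attained: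
  obtains f where "pid_function G f" "weight G f = perfect_Italian_domination_number G"
proof -
  have "\<exists>f. pid_function G f \<and> weight G f = perfect_Italian_domination_number G"
    unfolding perfect_Italian_domination_number_def
    by (rule LeastI_ex) (auto intro: pid_function_const_1)
  then show thesis using that by blast
qed

text \<open>Every element of \<open>D\<close> differs from \<open>v\<close>, hence is adjacent to
  \<open>v\<close> in exactly one of \<open>G\<close> and its complement.\<close>

lemma card_neighbours_complement:
  assumes "finite D" "D \<subseteq> pverts G" "v \<in> pverts G - D"
  shows "card (neighbours (complement G) v \<inter> D) + card (neighbours G v \<inter> D) = card D"
proof -
  have "neighbours (complement G) v \<inter> D = D - neighbours G v"
    using assms by (auto simp: neighbours_def complement_def)
  then show ?thesis
    using card_Diff_subset_Int[of D "neighbours G v"] card_mono[of D "neighbours G v \<inter> D"] assms(1)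
    by (auto simp: Int_commute)
qed

text \<open>A set of cardinality 1 is nonempty, so the exact count already yields
  domination.\<close>

lemma perfect_dominating_set_iff:
  "perfect_dominating_set G D \<longleftrightarrow>
    D \<subseteq> pverts G \<and> (\<forall>v \<in> pverts G - D. card (neighbours G v \<inter> D) = 1)"
proof -
  have "neighbours G v \<inter> D \<noteq> {}" if "card (neighbours G v \<inter> D) = 1" for v
    using that by auto
  then show ?thesis
    unfolding perfect_dominating_set_def dominating_set_def by blast
qed

lemma perfect_dominating_set_complement_card_3_iff:
  assumes "D \<subseteq> pverts G" "card D = 3"
  shows "perfect_dominating_set (complement G) D \<longleftrightarrow>
    (\<forall>v \<in> pverts G - D. card (neighbours G v \<inter> D) = 2)"
proof -
  have fin: "finite D"
    using assms(2) by (intro card_ge_0_finite) simp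
  have "card (neighbours (complement G) v \<inter> D) = 1 \<longleftrightarrow> card (neighbours G v \<inter> D) = 2"
    if "v \<in> pverts G - D" for v
    using card_neighbours_complement[OF fin assms(1) that] assms(2) by linarith
  moreover have "pverts (complement G) = pverts G"
    by (simp add: complement_def)
  ultimately show ?thesis
    using assms(1) by (simp add: perfect_dominating_set_iff)
qed

context pair_graph
begin

lemma finite_neighbours: "finite (neighbours G v)"
  by (simp add: neighbours_def pair_finite_verts)

lemma neighbours_nonempty_if_connected:
  assumes "Digraph_Component.connected (with_proj G)"
    and "a \<in> pverts G" "b \<in> pverts G" "a \<noteq> b"
  shows "neighbours G b \<noteq> {}"
proof -
  have "b \<rightarrow>\<^sup>*\<^bsub>with_proj (mk_symmetric (with_proj G))\<^esub> a"
    using assms by (auto simp: connected_def strongly_connected_def)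
  then obtain c where "b \<rightarrow>\<^bsub>with_proj (mk_symmetric (with_proj G))\<^esub> c"
    using assms(4) by (cases rule: pre_digraph.converse_reachable_cases) auto
  \<comment> \<open>The path from \<open>b\<close> to \<open>a\<close> lives in the symmetric
    closure, but \<open>G\<close> is symmetric, so its first arc lies in \<open>G\<close>
    itself.\<close>
  then have "(b, c) \<in> parcs G"
    by (auto simp: mk_symmetric_def intro: arcs_symmetric)
  then show ?thesis
    using in_arcsD2 by (auto simp: neighbours_def)
qed

text \<open>On vertices the indicator vanishes exactly outside \<open>D\<close>, and its sum over a
  neighbourhood counts the neighbours in \<open>D\<close>.\<close>

lemma pid_function_indicator_iff:
  assumes "D \<subseteq> pverts G"
  shows "pid_function G (indicator D) \<longleftrightarrow>
    (\<forall>v \<in> pverts G - D. card (neighbours G v \<inter> D) = 2)"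
  using finite_neighbours
  by (auto simp: pid_function_def indicator_eq_0_iff sum_indicator_eq_card indicator_def)

lemma weight_indicator:
  assumes "D \<subseteq> pverts G"
  shows "weight G (indicator D) = card D"
  using assms pair_finite_verts by (simp add: weight_def sum_indicator_eq_card Int_absorb1)

lemma pid_function_weight_3_cases:
  assumes "pid_function G f" "weight G f = 3"
  obtains (ones) D where "D \<subseteq> pverts G" "card D = 3" "pid_function G (indicator D)"
  | (two_one) a b where "a \<in> pverts G" "b \<in> pverts G" "a \<noteq> b"
      "\<forall>v \<in> pverts G - {a, b}. (v, a) \<in> parcs G \<and> (v, b) \<notin> parcs G"
proof (cases "\<exists>a \<in> pverts G. f a = 2")
  case True
  then obtain a where a: "a \<in> pverts G" "f a = 2" by blast
  \<comment> \<open>Removing the value 2 leaves weight 1; naturals summing to 1 have a single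
    nonzero term, which provides \<open>b\<close>.\<close>
  have "(\<Sum>v \<in> pverts G - {a}. f v) = 1"
    using assms(2) a sum.remove[OF pair_finite_verts a(1), of f] by (simp add: weight_def)
  then obtain b where "b \<in> pverts G - {a}" and "f b = 1"
    and "\<forall>v \<in> pverts G - {a}. b \<noteq> v \<longrightarrow> f v = 0"
    unfolding sum_eq_1_iff[OF finite_Diff[OF pair_finite_verts]] by blast
  then have b: "b \<in> pverts G" "b \<noteq> a" "f b = 1" and zero: "\<forall>v \<in> pverts G - {a, b}. f v = 0"
    by auto
  have "(v, a) \<in> parcs G \<and> (v, b) \<notin> parcs G" if v: "v \<in> pverts G - {a, b}" for v
  proof -
    have "2 = (\<Sum>u \<in> neighbours G v. f u)"
      using assms(1) zero v by (simp add: pid_function_def)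
    also have "\<dots> = (\<Sum>u \<in> neighbours G v \<inter> {a, b}. f u)"
      using finite_neighbours zero by (intro sum.mono_neutral_right) (auto simp: neighbours_def)
    finally have "2 = (\<Sum>u \<in> neighbours G v \<inter> {a, b}. f u)" .
    \<comment> \<open>The four adjacency patterns of \<open>v\<close> to \<open>a\<close> and
      \<open>b\<close> give the sums 0, 1, 2 and 3; only adjacency to \<open>a\<close> alone gives
      2.\<close>
    then show ?thesis
      using a b
      by (cases "a \<in> neighbours G v"; cases "b \<in> neighbours G v") (auto simp: neighbours_def)
  qed
  then show thesis
    using two_one a b by blast
next
  case False
  define D where "D = {v \<in> pverts G. f v = 1}"
  have D: "D \<subseteq> pverts G" by (auto simp: D_def)
  \<comment> \<open>Off the vertex set \<open>f\<close> is arbitrary, so the two functions are not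
    equal outright; weight and neighbourhood sums see only vertices.\<close>
  have eq: "f v = indicator D v" if "v \<in> pverts G" for v
    using assms(1) False that by (auto simp: pid_function_def D_def indicator_def)
  have "weight G (indicator D) = weight G f"
    unfolding weight_def by (intro sum.cong) (simp_all add: eq)
  then have "card D = 3"
    using assms(2) by (simp add: weight_indicator[OF D])
  have "sum (indicator D) (neighbours G v) = sum f (neighbours G v)" for v
    by (intro sum.cong) (simp_all add: eq neighbours_def)
  then have "pid_function G (indicator D)"
    using assms(1) eq unfolding pid_function_def by (simp add: Pi_iff)
  with D \<open>card D = 3\<close> show thesis
    by (rule ones)
qed

lemma pid_function_universal_vertex:
  assumes "\<forall>v \<in> pverts G - {a}. (v, a) \<in> parcs G"
  shows "pid_function G (\<lambda>v. if v = a then 2 else 0)"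
  using assms finite_neighbours in_arcsD2
  by (auto simp: pid_function_def neighbours_def)

lemma weight_universal_vertex:
  assumes "a \<in> pverts G"
  shows "weight G (\<lambda>v. if v = a then 2 else 0) = 2"
  using assms pair_finite_verts by (simp add: weight_def)

end

theorem theorem16:
  fixes G :: "'a pair_pre_digraph"
  assumes "pair_graph G"
    and "Digraph_Component.connected (with_proj G)"
    and "perfect_Italian_domination_number G > 2"
  shows "perfect_Italian_domination_number G = 3 \<longleftrightarrow>
    (\<exists>D. perfect_dominating_set (complement G) D \<and> card D = 3)"
proof -
  interpret pair_graph G by fact
  show ?thesis
  proof
    assume "perfect_Italian_domination_number G = 3"
    then obtain f where "pid_function G f" "weight G f = 3"
      using perfect_Italian_domination_number_attained by metis
    then show "\<exists>D. perfect_dominating_set (complement G) D \<and> card D = 3"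
    proof (rule pid_function_weight_3_cases, goal_cases ones two_one)
      case (ones D)
      then show ?thesis
        using pid_function_indicator_iff[of D] perfect_dominating_set_complement_card_3_iff[of D G] by auto
    next
      case (two_one a b)
      obtain c where c: "c \<in> pverts G" "(b, c) \<in> parcs G"
        using neighbours_nonempty_if_connected[OF assms(2) two_one(1-3)]
        by (auto simp: neighbours_def)
      have "c \<noteq> b"
        using c(2) no_loops by fastforce
      \<comment> \<open>Any other \<open>c\<close> would be one of the remaining vertices, none of
        which is adjacent to \<open>b\<close>.\<close>
      then have "c = a"
        using c two_one(4) arcs_symmetric by blast
      then have "pid_function G (\<lambda>v. if v = a then 2 else 0)"
        using two_one(4) c by (intro pid_function_universal_vertex) auto
      \<comment> \<open>This function has weight 2, contradicting the lower bound assumed for the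
        domination number.\<close>
      from perfect_Italian_domination_number_le[OF this] show ?thesis
        using assms(3) two_one(1) by (simp add: weight_universal_vertex)
    qed
  next
    assume "\<exists>D. perfect_dominating_set (complement G) D \<and> card D = 3"
    then obtain D where D: "perfect_dominating_set (complement G) D" "card D = 3"
      by blast
    then have sub: "D \<subseteq> pverts G"
      by (simp add: perfect_dominating_set_iff complement_def)
    then have "pid_function G (indicator D)"
      using D by (simp add: pid_function_indicator_iff perfect_dominating_set_complement_card_3_iff)
    \<comment> \<open>The indicator gives the upper bound 3; the hypothesis on \<open>G\<close>
      excludes anything smaller.\<close>
    from perfect_Italian_domination_number_le[OF this] show "perfect_Italian_domination_number G = 3"
      using assms(3) D(2) sub by (simp add: weight_indicator)
  qed
qed

end
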